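(* For all integers $n\geq 0$ and $\alpha\geq 0$, $$\overline{OPT}(2^\alpha(4n+3))\equiv 0 \pmod 4.$$
   Context: An overpartition of a nonnegative integer $n$ is a non-increasing sequence of positive integers with sum $n$ in which the first occurrence of each number may be overlined. An overpartition triple of $n$ with odd parts is an (ordered) triple $(\xi_1,\xi_2,\xi_3)$ of overpartitions, all of whose parts are odd, such that the sum of all the parts of $\xi_1,\xi_2,\xi_3$ is $n$. $\overline{OPT}(n)$ denotes the number of overpartition triples of $n$ with odd parts. Its generating function is $$\sum_{n\geq 0}\overline{OPT}(n)q^n=\frac{f_2^9}{f_1^6f_4^3}=\prod_{i\geq 0}\left(\frac{1+q^{2i+1}}{1-q^{2i+1}}\right)^3,\qquad f_k:=\prod_{i\geq 1}(1-q^{ki}).$$ *)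

theory Defs
  imports "HOL-Number_Theory.Cong"
begin

text \<open>
  An overpartition is a list of pairs (part, overlined?). Only the first occurrence of a
  number in the non-increasing sequence of parts may carry an overline.
\<close>

definition overpartition :: "(nat \<times> bool) list \<Rightarrow> bool" where
  "overpartition xs \<longleftrightarrow>
     sorted_wrt (\<ge>) (map fst xs) \<and>
     (\<forall>x\<in>set xs. fst x > 0) \<and>
     (\<forall>i<length xs. snd (xs ! i) \<longrightarrow> (\<forall>j<i. fst (xs ! j) \<noteq> fst (xs ! i)))"

definition odd_parts :: "(nat \<times> bool) list \<Rightarrow> bool" where
  "odd_parts xs \<longleftrightarrow> (\<forall>x\<in>set xs. odd (fst x))"

definition parts_sum :: "(nat \<times> bool) list \<Rightarrow> nat" where
  "parts_sum xs = sum_list (map fst xs)"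

definition odd_overpartition_triples ::
    "nat \<Rightarrow> ((nat \<times> bool) list \<times> (nat \<times> bool) list \<times> (nat \<times> bool) list) set" where
  "odd_overpartition_triples n =
     {(x, y, z). overpartition x \<and> overpartition y \<and> overpartition z \<and>
                 odd_parts x \<and> odd_parts y \<and> odd_parts z \<and>
                 parts_sum x + parts_sum y + parts_sum z = n}"

definition OPT :: "nat \<Rightarrow> nat" where
  "OPT n = card (odd_overpartition_triples n)"

text \<open>The set counted by \<open>OPT\<close> is finite, so its cardinality is the genuine count.\<close>

lemma overpartition_bounded:
  assumes "overpartition xs" "parts_sum xs \<le> n"
  shows "set xs \<subseteq> {..n} \<times> UNIV \<and> length xs \<le> n"
proof -
  have "length xs \<le> sum_list (map fst xs)" if "\<forall>x\<in>set xs. fst x > 0" for xs :: "(nat \<times> bool) list"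
    using that by (induction xs) auto
  moreover have "fst x \<le> sum_list (map fst xs)" if "x \<in> set xs" for x
    using that by (intro member_le_sum_list) auto
  ultimately show ?thesis
    using assms unfolding overpartition_def parts_sum_def by fastforce
qed

lemma finite_odd_overpartition_triples: "finite (odd_overpartition_triples n)"
proof -
  let ?L = "{xs :: (nat \<times> bool) list. set xs \<subseteq> {..n} \<times> UNIV \<and> length xs \<le> n}"
  have "odd_overpartition_triples n \<subseteq> ?L \<times> ?L \<times> ?L"
  proof
    fix t assume t: "t \<in> odd_overpartition_triples n"
    obtain x y z where [simp]: "t = (x, y, z)" by (cases t)
    have "overpartition x" "overpartition y" "overpartition z"
      and "parts_sum x \<le> n" "parts_sum y \<le> n" "parts_sum z \<le> n"
      using t by (auto simp: odd_overpartition_triples_def)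
    then show "t \<in> ?L \<times> ?L \<times> ?L"
      using overpartition_bounded by simp
  qed
  moreover have "finite ?L"
    by (rule finite_lists_length_le) auto
  ultimately show ?thesis
    by (meson finite_SigmaI finite_subset)
qed

end

theory Submission
  imports Defs
begin

text \<open>
  A partition with \<open>k\<close> distinct part sizes can be overlined in \<open>2^k\<close> ways, so modulo 4 only the
  triples with a single part size in total matter. These consist of one constant partition
  \<open>d + \<dots> + d\<close> and two empty ones; there are three for every odd divisor \<open>d\<close>, each counted twice.
  The odd divisors of \<open>2^\<alpha> (4 n + 3)\<close> are the divisors \<open>d\<close> of \<open>4 n + 3\<close>, and their number is even
  because \<open>d \<mapsto> (4 n + 3) / d\<close> exchanges the residue classes 1 and 3 modulo 4.
\<close>

section \<open>Counting the overlinings of a fixed list of parts\<close>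

definition overlinings :: "nat list \<Rightarrow> (nat \<times> bool) list set" where
  "overlinings l = {x. map fst x = l \<and>
     (\<forall>i<length x. snd (x ! i) \<longrightarrow> (\<forall>j<i. fst (x ! j) \<noteq> fst (x ! i)))}"

lemma map_fst_overlinings: "x \<in> overlinings l \<Longrightarrow> map fst x = l"
  by (simp add: overlinings_def)

lemma overlinings_Nil: "overlinings [] = {[]}"
  by (auto simp: overlinings_def)

text \<open>Appending at the end leaves all earlier indices alone, so the first-occurrence condition
  changes only for the new entry, which may be overlined exactly if its value is new. Hence the
  induction from the right, over lists that need not be sorted.\<close>

lemma overlinings_snoc:
  "overlinings (l @ [a]) =
     (\<lambda>(x, b). x @ [(a, b)]) ` (overlinings l \<times> {b. b \<longrightarrow> a \<notin> set l})"
proof -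
  have "x @ [(a, b)] \<in> overlinings (l @ [a]) \<longleftrightarrow> x \<in> overlinings l \<and> (b \<longrightarrow> a \<notin> set l)" for x b
  proof (cases "map fst x = l")
    case True
    then have "a \<notin> set l \<longleftrightarrow> (\<forall>j<length x. fst (x ! j) \<noteq> a)"
      by (auto simp: in_set_conv_nth)
    with True show ?thesis
      by (auto simp: overlinings_def nth_append less_Suc_eq all_conj_distrib imp_conjL)
  qed (simp add: overlinings_def)
  moreover have "\<exists>x b. y = x @ [(a, b)]" if "y \<in> overlinings (l @ [a])" for y
  proof -
    from that have "map fst y = l @ [a]" by (simp add: overlinings_def)
    then show ?thesis
      by (cases y rule: rev_cases) auto
  qed
  ultimately show ?thesis
    by (intro set_eqI iffI; (elim imageE)?) (force, auto)
qed

lemma card_overlinings: "card (overlinings l) = 2 ^ card (set l)"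
proof (induction l rule: rev_induct)
  case Nil
  then show ?case by (simp add: overlinings_Nil)
next
  case (snoc a l)
  have "inj_on (\<lambda>(x, b). x @ [(a, b)]) (overlinings l \<times> {b. b \<longrightarrow> a \<notin> set l})"
    by (auto simp: inj_on_def)
  then have "card (overlinings (l @ [a])) = card (overlinings l) * card {b. b \<longrightarrow> a \<notin> set l}"
    by (simp add: overlinings_snoc card_image card_cartesian_product)
  \<comment> \<open>A repeated value admits only the plain copy; a new value doubles the
    count.\<close>
  moreover have "{b. b \<longrightarrow> a \<notin> set l} = (if a \<in> set l then {False} else {False, True})"
    by auto
  ultimately show ?case
    using snoc by (simp add: insert_absorb)
qed

lemma finite_overlinings: "finite (overlinings l)"
  by (rule card_ge_0_finite) (simp add: card_overlinings)

section \<open>Grouping the triples by their underlying partitions\<close>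

definition odd_partition :: "nat list \<Rightarrow> bool" where
  "odd_partition l \<longleftrightarrow> sorted_wrt (\<ge>) l \<and> (\<forall>a\<in>set l. odd a)"

text \<open>Separates the conditions on the part sizes from those on the overlines. Positivity of
  the parts is absorbed by oddness.\<close>

lemma odd_overpartition_iff:
  "overpartition x \<and> odd_parts x \<longleftrightarrow> odd_partition (map fst x) \<and> x \<in> overlinings (map fst x)"
  unfolding overpartition_def odd_parts_def odd_partition_def overlinings_def
  by (auto intro: odd_pos)

definition odd_partition_triples :: "nat \<Rightarrow> (nat list \<times> nat list \<times> nat list) set" where
  "odd_partition_triples n = {(a, b, c). odd_partition a \<and> odd_partition b \<and> odd_partition c \<and>
     sum_list a + sum_list b + sum_list c = n}"

lemma odd_overpartition_triples_eq:
  "odd_overpartition_triples n =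
     (\<Union>(a, b, c)\<in>odd_partition_triples n. overlinings a \<times> overlinings b \<times> overlinings c)"
proof (intro set_eqI iffI)
  fix t assume "t \<in> odd_overpartition_triples n"
  then obtain x y z where t: "t = (x, y, z)"
    and xyz: "overpartition x \<and> odd_parts x" "overpartition y \<and> odd_parts y"
      "overpartition z \<and> odd_parts z"
    and n: "parts_sum x + parts_sum y + parts_sum z = n"
    by (auto simp: odd_overpartition_triples_def)
  have "(map fst x, map fst y, map fst z) \<in> odd_partition_triples n"
    using xyz n unfolding odd_overpartition_iff
    by (simp add: odd_partition_triples_def parts_sum_def)
  moreover have "t \<in> overlinings (map fst x) \<times> overlinings (map fst y) \<times> overlinings (map fst z)"
    using xyz unfolding odd_overpartition_iff t by simp
  ultimately show "t \<in> (\<Union>(a, b, c)\<in>odd_partition_triples n.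
      overlinings a \<times> overlinings b \<times> overlinings c)"
    by blast
next
  fix t assume "t \<in> (\<Union>(a, b, c)\<in>odd_partition_triples n.
      overlinings a \<times> overlinings b \<times> overlinings c)"
  then obtain a b c x y z where t: "t = (x, y, z)" "(a, b, c) \<in> odd_partition_triples n"
    and xyz: "x \<in> overlinings a" "y \<in> overlinings b" "z \<in> overlinings c"
    by auto
  have abc: "a = map fst x" "b = map fst y" "c = map fst z"
    using xyz by (simp_all add: map_fst_overlinings)
  have "overpartition x \<and> odd_parts x" "overpartition y \<and> odd_parts y"
    "overpartition z \<and> odd_parts z"
    using t(2) xyz unfolding odd_overpartition_iff abc by (simp_all add: odd_partition_triples_def)
  then show "t \<in> odd_overpartition_triples n"
    using t(2) unfolding t(1) abc
    by (simp add: odd_partition_triples_def odd_overpartition_triples_def parts_sum_def)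
qed

lemma overlinings_nonempty: "overlinings l \<noteq> {}"
proof
  assume "overlinings l = {}"
  then have "card (overlinings l) = 0" by (simp only: card.empty)
  then show False unfolding card_overlinings by simp
qed

text \<open>Every list has at least one overlining, so erasing overlines maps the finite set of
  overpartition triples onto these triples.\<close>

lemma finite_odd_partition_triples: "finite (odd_partition_triples n)"
proof (rule finite_subset)
  let ?f = "\<lambda>(x, y, z). (map fst x, map fst y, map fst z)"
  show "odd_partition_triples n \<subseteq> ?f ` odd_overpartition_triples n"
  proof
    fix t assume t: "t \<in> odd_partition_triples n"
    obtain a b c where abc: "t = (a, b, c)" by (cases t)
    obtain x y z where xyz: "x \<in> overlinings a" "y \<in> overlinings b" "z \<in> overlinings c"
      using overlinings_nonempty by (meson ex_in_conv)
    then have "(x, y, z) \<in> odd_overpartition_triples n"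
      using t unfolding odd_overpartition_triples_eq abc by blast
    moreover have "?f (x, y, z) = t"
      by (simp only: prod.case abc xyz[THEN map_fst_overlinings])
    ultimately show "t \<in> ?f ` odd_overpartition_triples n"
      by (intro rev_image_eqI[of "(x, y, z)"]) (simp_all only:)
  qed
qed (simp add: finite_odd_overpartition_triples)

definition part_sizes :: "nat list \<times> nat list \<times> nat list \<Rightarrow> nat" where
  "part_sizes = (\<lambda>(a, b, c). card (set a) + card (set b) + card (set c))"

text \<open>Erasing the overlines recovers the index triple, so the union is disjoint; each block is
  a product of three sets whose sizes are powers of 2.\<close>

lemma OPT_eq_sum: "OPT n = (\<Sum>t\<in>odd_partition_triples n. 2 ^ part_sizes t)"
proof -
  let ?O = "\<lambda>(a, b, c). overlinings a \<times> overlinings b \<times> overlinings c"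
  have "OPT n = (\<Sum>t\<in>odd_partition_triples n. card (?O t))"
    unfolding OPT_def odd_overpartition_triples_eq
  proof (rule card_UN_disjoint)
    show "\<forall>s\<in>odd_partition_triples n. \<forall>t\<in>odd_partition_triples n. s \<noteq> t \<longrightarrow> ?O s \<inter> ?O t = {}"
      by (auto dest!: map_fst_overlinings)
  qed (auto simp: finite_odd_partition_triples finite_overlinings)
  also have "\<dots> = (\<Sum>t\<in>odd_partition_triples n. 2 ^ part_sizes t)"
    by (intro sum.cong)
      (auto simp: part_sizes_def card_cartesian_product card_overlinings power_add)
  finally show ?thesis .
qed

section \<open>Triples with a single part size, and reduction modulo 4\<close>

definition constant_odd_partitions :: "nat \<Rightarrow> nat list set" where
  "constant_odd_partitions n = {l. odd_partition l \<and> sum_list l = n \<and> card (set l) = 1}"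

text \<open>If the only part size is \<open>d\<close>, the sum \<open>n\<close> forces
  \<open>d dvd n\<close> and multiplicity \<open>n div d\<close>. For \<open>n > 0\<close> this
  multiplicity is positive, so \<open>d\<close> really occurs.\<close>

lemma constant_odd_partitions_eq:
  assumes "n > 0"
  shows "constant_odd_partitions n = (\<lambda>d. replicate (n div d) d) ` {d. odd d \<and> d dvd n}"
proof (intro set_eqI iffI)
  fix l assume "l \<in> constant_odd_partitions n"
  then have l: "odd_partition l" "sum_list l = n" "card (set l) = 1"
    by (simp_all add: constant_odd_partitions_def)
  from l(3) obtain d where d: "set l = {d}"
    by (auto simp: card_1_singleton_iff)
  then have "l = replicate (length l) d"
    by (metis replicate_eqI singletonD)
  then obtain m where m: "l = replicate m d" ..
  have "odd d" using l(1) d by (simp add: odd_partition_def)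
  moreover have "n = m * d" using l(2) m by (simp add: sum_list_replicate)
  ultimately show "l \<in> (\<lambda>d. replicate (n div d) d) ` {d. odd d \<and> d dvd n}"
    using m by (auto simp: image_iff intro!: exI[of _ d] dest: odd_pos)
next
  fix l assume "l \<in> (\<lambda>d. replicate (n div d) d) ` {d. odd d \<and> d dvd n}"
  then obtain d where d: "odd d" "d dvd n" "l = replicate (n div d) d"
    by auto
  then have "n div d > 0"
    using assms by (simp add: dvd_imp_le odd_pos div_greater_zero_iff)
  then have "set l = {d}" using d(3) by simp
  moreover have "sorted_wrt (\<ge>) l"
    unfolding d(3) by (simp add: sorted_wrt_iff_nth_less)
  moreover have "sum_list l = n"
    using d by (simp add: sum_list_replicate)
  ultimately show "l \<in> constant_odd_partitions n"
    using d(1) by (simp add: constant_odd_partitions_def odd_partition_def)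
qed

lemma card_constant_odd_partitions:
  assumes "n > 0"
  shows "card (constant_odd_partitions n) = card {d. odd d \<and> d dvd n}"
proof -
  have "inj_on (\<lambda>d. replicate (n div d) d) {d. odd d \<and> d dvd n}"
  proof (rule inj_onI)
    fix d e
    assume "d \<in> {d. odd d \<and> d dvd n}" "e \<in> {d. odd d \<and> d dvd n}"
      and eq: "replicate (n div d) d = replicate (n div e) e"
    \<comment> \<open>The lists are nonempty, so their common entry can be read off.\<close>
    then have "n div d > 0"
      using assms by (simp add: dvd_imp_le odd_pos div_greater_zero_iff)
    then show "d = e"
      using eq by (metis replicate_eq_replicate less_numeral_extra(3))
  qed
  then show ?thesis
    by (simp add: constant_odd_partitions_eq assms card_image)
qed

lemma card_single_size_triples:
  assumes "n > 0"
  shows "card {t \<in> odd_partition_triples n. part_sizes t = 1} = 3 * card {d. odd d \<and> d dvd n}"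
proof -
  let ?C = "constant_odd_partitions n"
  have fin: "finite ?C"
    using assms by (simp add: constant_odd_partitions_eq)
  \<comment> \<open>This makes the three blocks below, one for each position of the nonempty
    partition, disjoint.\<close>
  have ne: "[] \<notin> ?C"
    by (simp add: constant_odd_partitions_def)
  have "{t \<in> odd_partition_triples n. part_sizes t = 1} =
      ?C \<times> {[]} \<times> {[]} \<union> ({[]} \<times> ?C \<times> {[]} \<union> {[]} \<times> {[]} \<times> ?C)" (is "?L = ?R")
  proof -
    have sum_1: "i + j + k = 1 \<longleftrightarrow> i = 1 \<and> j = 0 \<and> k = 0 \<or> i = 0 \<and> j = 1 \<and> k = 0 \<or>
        i = 0 \<and> j = 0 \<and> k = 1" for i j k :: nat
      by arith
    have card_0: "card (set l) = 0 \<longleftrightarrow> l = []" for l :: "nat list"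
      by simp
    have "odd_partition []"
      by (simp add: odd_partition_def)
    then have "(a, b, c) \<in> ?L \<longleftrightarrow> (a, b, c) \<in> ?R" for a b c
      unfolding mem_Collect_eq odd_partition_triples_def part_sizes_def constant_odd_partitions_def
        prod.case sum_1 card_0 Un_iff mem_Sigma_iff singleton_iff
      by (cases "a = []"; cases "b = []"; cases "c = []") auto
    then show ?thesis by auto
  qed
  also have "card \<dots> = card (?C \<times> {[] :: nat list} \<times> {[] :: nat list}) +
      (card ({[] :: nat list} \<times> ?C \<times> {[] :: nat list}) +
       card ({[] :: nat list} \<times> {[] :: nat list} \<times> ?C))"
    using fin ne by (subst card_Un_disjoint; (subst card_Un_disjoint)?) auto
  also have "\<dots> = 3 * card ?C"
    by (simp add: card_cartesian_product)
  finally show ?thesis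
    by (simp add: card_constant_odd_partitions assms)
qed

text \<open>A triple with at least two part sizes, counted per component, contributes a multiple of
  4. Each of the three triples per odd divisor contributes 2, whence the factor 6.\<close>

lemma OPT_cong_odd_divisors:
  assumes "n > 0"
  shows "[OPT n = 6 * card {d. odd d \<and> d dvd n}] (mod 4)"
proof -
  let ?T = "odd_partition_triples n"
  let ?K = "{t \<in> ?T. part_sizes t = 1}"
  \<comment> \<open>As \<open>n > 0\<close>, the triple of empty partitions, whose summand would be
    1, does not occur.\<close>
  have pos: "part_sizes t > 0" if "t \<in> ?T" for t
    using that assms by (auto simp: odd_partition_triples_def part_sizes_def card_gt_0_iff)
  have "4 dvd (\<Sum>t\<in>?T - ?K. 2 ^ part_sizes t :: nat)"
  proof (rule dvd_sum)
    fix t assume "t \<in> ?T - ?K"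
    then have "2 \<le> part_sizes t" using pos[of t] by auto
    then show "4 dvd (2 ^ part_sizes t :: nat)"
      using le_imp_power_dvd[of 2 "part_sizes t" "2 :: nat"] by simp
  qed
  moreover have "(\<Sum>t\<in>?K. 2 ^ part_sizes t) = 6 * card {d. odd d \<and> d dvd n}"
    using card_single_size_triples[OF assms] by simp
  moreover have "OPT n = (\<Sum>t\<in>?T - ?K. 2 ^ part_sizes t) + (\<Sum>t\<in>?K. 2 ^ part_sizes t)"
    unfolding OPT_eq_sum by (rule sum.subset_diff) (auto simp: finite_odd_partition_triples)
  ultimately show ?thesis
    by (auto simp: cong_def)
qed

section \<open>Parity of the number of odd divisors\<close>

lemma even_card_divisors:
  fixes m :: nat
  assumes "m mod 4 = 3"
  shows "even (card {d. d dvd m})"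
proof -
  let ?D = "\<lambda>r. {d. d dvd m \<and> d mod 4 = r}"
  have m: "m > 0" using assms by (cases m) auto
  have cofactor: "d mod 4 = 1 \<and> e mod 4 = 3 \<or> d mod 4 = 3 \<and> e mod 4 = 1"
    if "d * e = m" for d e
  proof -
    \<comment> \<open>Among the residue pairs modulo 4, only (1, 3) and (3, 1) have product
      3.\<close>
    have "(d mod 4) * (e mod 4) mod 4 = 3"
      using that assms by (metis mod_mult_eq)
    moreover have "d mod 4 \<in> {0, 1, 2, 3}" "e mod 4 \<in> {0, 1, 2, 3}"
      by auto
    ultimately show ?thesis by auto
  qed
  have mem: "m div d dvd m \<and> m div (m div d) = d \<and> d * (m div d) = m" if "d dvd m" for d
    using that m by auto
  \<comment> \<open>Passing to the cofactor is an involution on the divisors, so it serves as its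
    own inverse.\<close>
  have "bij_betw (\<lambda>d. m div d) (?D 1) (?D 3)"
    using mem cofactor by (intro bij_betw_byWitness[where f' = "\<lambda>d. m div d"]) fastforce+
  then have "card (?D 1) = card (?D 3)"
    by (rule bij_betw_same_card)
  moreover have "{d. d dvd m} = ?D 1 \<union> ?D 3"
    using mem cofactor by blast
  moreover have "card (?D 1 \<union> ?D 3) = card (?D 1) + card (?D 3)"
    using m by (intro card_Un_disjoint) auto
  ultimately have "card {d. d dvd m} = card (?D 3) + card (?D 3)"
    by (simp only:)
  then show ?thesis by (simp only: even_add)
qed

text \<open>An odd \<open>d\<close> is coprime to \<open>2 ^ \<alpha>\<close>, so it must divide the
  other factor. This removes the dependence on \<alpha>.\<close>

lemma odd_divisors_pow2_mult:
  fixes m :: nat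
  assumes "odd m"
  shows "{d. odd d \<and> d dvd 2 ^ \<alpha> * m} = {d. d dvd m}"
proof -
  have "odd d \<and> d dvd 2 ^ \<alpha> * m \<longleftrightarrow> d dvd m" for d
  proof
    assume d: "odd d \<and> d dvd 2 ^ \<alpha> * m"
    then have "coprime d (2 ^ \<alpha>)" by simp
    from coprime_dvd_mult_right_iff[OF this, of m] d show "d dvd m" by (simp only:)
  next
    assume d: "d dvd m"
    then have "odd d" using assms by (meson dvd_trans)
    then show "odd d \<and> d dvd 2 ^ \<alpha> * m" using d by (intro conjI dvd_mult)
  qed
  then show ?thesis by (simp only:)
qed

theorem theorem2p1:
  fixes n \<alpha> :: nat
  shows "[OPT (2 ^ \<alpha> * (4 * n + 3)) = 0] (mod 4)"
proof -
  have "even (card {d. odd d \<and> d dvd 2 ^ \<alpha> * (4 * n + 3)})"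
    using even_card_divisors[of "4 * n + 3"] by (simp add: odd_divisors_pow2_mult)
  \<comment> \<open>One factor 2 comes from 6, the other from the even number of divisors.\<close>
  then have "4 dvd 6 * card {d. odd d \<and> d dvd 2 ^ \<alpha> * (4 * n + 3)}"
    by auto
  then show ?thesis
    using OPT_cong_odd_divisors[of "2 ^ \<alpha> * (4 * n + 3)"] by (simp add: cong_def mod_eq_0_iff_dvd)
qed

end
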